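(* Let $G_1$ and $G_2$ be finite simple graphs of orders $n_1$ and $n_2$, respectively. If $\mathcal{B}^{m}_{n_1}(G_1)\cong \mathcal{B}^{m}_{n_2}(G_2)$ as multigraphs, then the cores $G_1^{\circ}$ and $G_2^{\circ}$ are isomorphic.
   Context: A stable $k$-partition of a graph $G$ is a multiset $P=\{V_1,\dots,V_k\}$ of $k$ independent sets of $G$ (some possibly empty) that partition $V(G)$. For $v\in V(G)$, $P-v$ denotes the multiset $\{V_i\setminus\{v\}:1\le i\le k\}$. The Bell $k$-coloring multigraph $\mathcal{B}^{m}_k(G)$ has as vertices all stable $k$-partitions of $G$, and for each pair of distinct partitions $P,Q$ it has one (parallel) edge between $P$ and $Q$ for each vertex $v\in V(G)$ with $P-v=Q-v$. A vertex $v$ of $G$ is universal if it is adjacent to every other vertex of $G$. The core $G^{\circ}$ of $G$ is the induced subgraph of $G$ on the set of non-universal vertices. *)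

theory Defs
  imports
    "Graph_Theory.Digraph_Component"
    "Graph_Theory.Digraph_Isomorphism"
    "HOL-Library.Multiset"
    "HOL-Library.Disjoint_Sets"
begin

text \<open>
  Finite simple graphs are those of the locale \<^locale>\<open>graph\<close>: finite symmetric loop-free
  digraphs without parallel arcs, an undirected edge being a pair of opposite arcs. For such
  digraphs, \<^const>\<open>digraph_iso\<close> is graph isomorphism.
\<close>

definition independent_in :: "('a, 'b) pre_digraph \<Rightarrow> 'a set \<Rightarrow> bool" where
  "independent_in G S \<longleftrightarrow> S \<subseteq> verts G \<and> (\<forall>u\<in>S. \<forall>w\<in>S. \<not> u \<rightarrow>\<^bsub>G\<^esub> w)"

definition universal_vertex :: "('a, 'b) pre_digraph \<Rightarrow> 'a \<Rightarrow> bool" where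
  "universal_vertex G v \<longleftrightarrow> v \<in> verts G \<and> (\<forall>u \<in> verts G - {v}. v \<rightarrow>\<^bsub>G\<^esub> u)"

definition core :: "('a, 'b) pre_digraph \<Rightarrow> ('a, 'b) pre_digraph" where
  "core G = G \<restriction> {v \<in> verts G. \<not> universal_vertex G v}"

text \<open>
  The parts are indexed by \<open>{..<k}\<close>, so disjointness of the family forces a repeated part to be
  empty.
\<close>

definition stable_partition :: "('a, 'b) pre_digraph \<Rightarrow> nat \<Rightarrow> 'a set multiset \<Rightarrow> bool" where
  "stable_partition G k P \<longleftrightarrow>
     (\<exists>V. P = image_mset V (mset_set {..<k}) \<and>
          (\<forall>i<k. independent_in G (V i)) \<and>
          disjoint_family_on V {..<k} \<and>
          (\<Union>i<k. V i) = verts G)"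

definition delete_vertex :: "'a set multiset \<Rightarrow> 'a \<Rightarrow> 'a set multiset" where
  "delete_vertex P v = image_mset (\<lambda>S. S - {v}) P"

record ('v, 'e) multigraph =
  mverts :: "'v set"
  medges :: "'e set"
  mends :: "'e \<Rightarrow> 'v set"

definition multigraph_iso :: "('v, 'e) multigraph \<Rightarrow> ('w, 'f) multigraph \<Rightarrow> bool" where
  "multigraph_iso M N \<longleftrightarrow>
     (\<exists>f g. bij_betw f (mverts M) (mverts N) \<and>
            bij_betw g (medges M) (medges N) \<and>
            (\<forall>e \<in> medges M. mends N (g e) = f ` mends M e))"

text \<open>An edge carries the vertex of \<open>G\<close> producing it, which keeps parallel edges apart.\<close>

definition bell_multigraph ::
    "nat \<Rightarrow> ('a, 'b) pre_digraph \<Rightarrow> ('a set multiset, 'a set multiset set \<times> 'a) multigraph" where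
  "bell_multigraph k G =
     \<lparr> mverts = {P. stable_partition G k P},
       medges = {({P, Q}, v) | P Q v. stable_partition G k P \<and> stable_partition G k Q \<and> P \<noteq> Q \<and>
                   v \<in> verts G \<and> delete_vertex P v = delete_vertex Q v},
       mends = fst \<rparr>"

end

theory Submission
  imports Defs
begin

text \<open>
  Let \<open>H\<close> be the complement of \<open>G\<close>, with edge set \<open>E\<close>. Since \<open>k = n\<close>, a stable partition is
  determined by the set \<open>F \<subseteq> E\<close> of pairs lying in a common part, and the sets arising are the
  transitive ones. The edges of the Bell multigraph between \<open>F\<close> and \<open>F'\<close> correspond to the
  vertices common to all pairs in the symmetric difference of \<open>F\<close> and \<open>F'\<close>. Hence \<open>F\<close> and \<open>F'\<close> are
  joined by a double edge iff they differ in exactly one pair.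

  The number of double edges at \<open>F\<close> is at most \<open>|E|\<close>, with equality at \<open>{}\<close>, and otherwise only if
  \<open>F\<close> consists of isolated edges of \<open>H\<close>. In that case the symmetric difference with \<open>F\<close> is an
  automorphism taking \<open>F\<close> to \<open>{}\<close>, so an isomorphism of Bell multigraphs may be assumed to map \<open>{}\<close>
  to \<open>{}\<close>. It then induces a bijection of the edges of the complements. Disjointness of two edges,
  and whether three pairwise intersecting edges form a star or a triangle, can be read off from the
  multigraph; so the bijection preserves the size of the intersection of every nonempty set of edges.
  By inclusion-exclusion it preserves the number of vertices with any given nonempty set of incident
  edges, which gives an isomorphism of the complements up to isolated vertices. The isolated
  vertices of \<open>H\<close> are the universal vertices of \<open>G\<close>.
\<close>

section \<open>Families of pairs\<close>

text \<open>The edge sets of cluster graphs, that is, of disjoint unions of cliques, with all edges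
  in \<open>E\<close>. Symmetry comes with unordered pairs, and \<open>x \<noteq> z\<close> exempts
  walking back along the same pair, which would otherwise demand a singleton.\<close>

definition cluster_edges :: "'a set set \<Rightarrow> 'a set set set" where
  "cluster_edges E =
     {F. F \<subseteq> E \<and> (\<forall>x y z. {x, y} \<in> F \<longrightarrow> {y, z} \<in> F \<longrightarrow> x \<noteq> z \<longrightarrow> {x, z} \<in> F)}"

definition star :: "'a set set \<Rightarrow> 'a \<Rightarrow> 'a set set" where
  "star E v = {e \<in> E. v \<in> e}"

lemma cluster_edgesD:
  assumes "F \<in> cluster_edges E" "{x, y} \<in> F" "{y, z} \<in> F" "x \<noteq> z"
  shows "{x, z} \<in> F"
  using assms unfolding cluster_edges_def by blast

lemma empty_in_cluster_edges: "{} \<in> cluster_edges E"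
  by (simp add: cluster_edges_def)

lemma singleton_in_cluster_edges:
  assumes "e \<in> E" "card e = 2"
  shows "{e} \<in> cluster_edges E"
proof -
  have False if "{x, y} = e" "{y, z} = e" "x \<noteq> z" for x y z
  proof -
    have "x = y" using that by blast
    then show False using that(1) assms(2) by auto
  qed
  then show ?thesis using assms(1) unfolding cluster_edges_def by blast
qed

lemma card_2_Int_eq_singleton:
  assumes "card e = 2" "card f = 2" "e \<noteq> f" "v \<in> e" "v \<in> f"
  shows "e \<inter> f = {v}"
proof -
  obtain x where x: "e = {v, x}" using assms(1,4) by (metis card_2_iff insertE insert_commute singletonD)
  obtain y where y: "f = {v, y}" using assms(2,5) by (metis card_2_iff insertE insert_commute singletonD)
  show ?thesis using x y assms(3) by auto
qed

lemma card_2_subset_eq: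
  assumes "card e = 2" "card f = 2" "e \<subseteq> f"
  shows "e = f"
  by (rule card_subset_eq) (use assms card_ge_0_finite[of f] in auto)

text \<open>Distinct pairs share at most one vertex, so two common vertices leave room for a single
  pair. In this way a double edge of the multigraph marks the change of exactly one pair.\<close>

lemma card_Inter_eq_2_iff:
  assumes "\<And>e. e \<in> S \<Longrightarrow> card e = 2" "S \<noteq> {}"
  shows "card (\<Inter> S) = 2 \<longleftrightarrow> (\<exists>e. S = {e})"
proof
  assume c: "card (\<Inter> S) = 2"
  have "\<Inter> S = e" if "e \<in> S" for e
    using card_2_subset_eq[OF c assms(1)[OF that]] that by blast
  with assms(2) show "\<exists>e. S = {e}" by blast
qed (use assms in auto)

text \<open>\<open>card\<close> also vanishes on infinite sets; any member of \<open>S\<close>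
  bounds the intersection and excludes that reading.\<close>

lemma card_Inter_eq_0_iff:
  assumes "\<And>e. e \<in> S \<Longrightarrow> card e = 2" "S \<noteq> {}"
  shows "card (\<Inter> S) = 0 \<longleftrightarrow> \<Inter> S = {}"
proof -
  obtain e where "e \<in> S" using assms(2) by blast
  then have "finite (\<Inter> S)"
    using assms(1) card_ge_0_finite[of e] by (intro finite_subset[of "\<Inter> S" e]) auto
  then show ?thesis by simp
qed

text \<open>Families of pairs have Helly number three, so triple intersections determine everything.\<close>

lemma card_Inter_pairs:
  assumes "\<And>e. e \<in> A \<Longrightarrow> card e = 2" "A \<noteq> {}"
  shows "card (\<Inter> A) =
    (if \<exists>e. A = {e} then 2
     else if \<forall>e\<in>A. \<forall>f\<in>A. \<forall>g\<in>A. e \<inter> f \<inter> g \<noteq> {} then 1 else 0)"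
proof (cases "\<exists>e. A = {e}")
  case True
  then show ?thesis using assms by auto
next
  case False
  then obtain e f where ef: "e \<in> A" "f \<in> A" "e \<noteq> f"
    using assms(2) by blast
  show ?thesis
  proof (cases "\<forall>e\<in>A. \<forall>f\<in>A. \<forall>g\<in>A. e \<inter> f \<inter> g \<noteq> {}")
    case helly: True
    then obtain v where v: "v \<in> e" "v \<in> f" using ef by blast
    have I: "e \<inter> f = {v}"
      by (rule card_2_Int_eq_singleton[OF assms(1)[OF ef(1)] assms(1)[OF ef(2)] ef(3) v])
    \<comment> \<open>Testing the triples that consist of the two fixed members and an arbitrary
      third one suffices.\<close>
    have "v \<in> g" if "g \<in> A" for g
      using helly[rule_format, OF ef(1,2) that] unfolding I by simp
    moreover have "\<Inter> A \<subseteq> {v}" using ef(1,2) unfolding I[symmetric] by blast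
    ultimately have "\<Inter> A = {v}" by blast
    then show ?thesis using False helly by simp
  next
    case nohelly: False
    then have "\<Inter> A = {}" by blast
    then show ?thesis using False nohelly by simp
  qed
qed

text \<open>The case formula for \<open>card (\<Inter> A)\<close> depends only on whether
  \<open>A\<close> is a singleton and on which triples meet. Injectivity of \<open>\<phi>\<close>
  keeps the first, \<open>triple\<close> the second; triples may repeat members, so pairwise
  intersections are covered too.\<close>

lemma card_Inter_image_eq:
  assumes "\<And>e. e \<in> E \<Longrightarrow> card e = 2" "\<And>e. e \<in> E \<Longrightarrow> card (\<phi> e) = 2" "inj_on \<phi> E"
    and triple: "\<And>e f g. \<lbrakk>e \<in> E; f \<in> E; g \<in> E\<rbrakk> \<Longrightarrow>
                   e \<inter> f \<inter> g = {} \<longleftrightarrow> \<phi> e \<inter> \<phi> f \<inter> \<phi> g = {}"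
    and A: "A \<subseteq> E" "A \<noteq> {}"
  shows "card (\<Inter> A) = card (\<Inter> (\<phi> ` A))"
proof -
  have "(\<exists>e. A = {e}) \<longleftrightarrow> card A = 1" by (simp add: card_1_singleton_iff)
  also have "\<dots> \<longleftrightarrow> card (\<phi> ` A) = 1"
    using card_image[of \<phi> A] inj_on_subset[OF assms(3) A(1)] by simp
  also have "\<dots> \<longleftrightarrow> (\<exists>e. \<phi> ` A = {e})" by (simp add: card_1_singleton_iff)
  finally have sing: "(\<exists>e. A = {e}) \<longleftrightarrow> (\<exists>e. \<phi> ` A = {e})" .
  have tr: "(\<forall>e\<in>A. \<forall>f\<in>A. \<forall>g\<in>A. e \<inter> f \<inter> g \<noteq> {}) \<longleftrightarrow>
            (\<forall>e\<in>\<phi> ` A. \<forall>f\<in>\<phi> ` A. \<forall>g\<in>\<phi> ` A. e \<inter> f \<inter> g \<noteq> {})"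
    using triple A(1) by (simp add: subset_iff)
  have 1: "card (\<Inter> A) = (if \<exists>e. A = {e} then 2
     else if \<forall>e\<in>A. \<forall>f\<in>A. \<forall>g\<in>A. e \<inter> f \<inter> g \<noteq> {} then 1 else 0)"
    by (rule card_Inter_pairs) (use assms A in auto)
  have 2: "card (\<Inter> (\<phi> ` A)) = (if \<exists>e. \<phi> ` A = {e} then 2
     else if \<forall>e\<in>\<phi> ` A. \<forall>f\<in>\<phi> ` A. \<forall>g\<in>\<phi> ` A. e \<inter> f \<inter> g \<noteq> {} then 1 else 0)"
    by (rule card_Inter_pairs) (use assms A in auto)
  show ?thesis unfolding 1 2 sing tr ..
qed

section \<open>Counting vertices by their exact sets of incident edges\<close>

text \<open>A vertex lies in every member of \<open>A\<close> iff its star contains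
  \<open>A\<close>; the count is split by the exact star, with \<open>A\<close> itself set apart for
  induction. Since \<open>A\<close> is nonempty, all fibres lie in a finite edge, even over an
  infinite type.\<close>

lemma card_Inter_eq_sum_stars:
  assumes "finite E" "\<And>e. e \<in> E \<Longrightarrow> finite e" "A \<subseteq> E" "A \<noteq> {}"
  shows "card (\<Inter> A) = card {v. star E v = A} + (\<Sum>B | A \<subset> B \<and> B \<subseteq> E. card {v. star E v = B})"
proof -
  let ?I = "{B. A \<subset> B \<and> B \<subseteq> E}"
  have finI: "finite ?I" by (rule finite_subset[of _ "Pow E"]) (use assms(1) in auto)
  have fin: "finite {v. star E v = B}" if "A \<subseteq> B" for B
  proof -
    obtain e where "e \<in> A" using assms(4) by blast
    then have "{v. star E v = B} \<subseteq> e" "finite e"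
      using that assms unfolding star_def by auto
    then show ?thesis by (rule finite_subset)
  qed
  have "\<Inter> A = (\<Union>B \<in> insert A ?I. {v. star E v = B})"
    using assms(3,4) unfolding star_def by auto
  then have "card (\<Inter> A) = (\<Sum>B \<in> insert A ?I. card {v. star E v = B})"
    using finI fin by (simp only:) (rule card_UN_disjoint; auto)
  then show ?thesis using finI by simp
qed

text \<open>Inclusion-exclusion in the form of an induction from large \<open>A\<close> to small:
  the vertices with star exactly \<open>A\<close> are those common to \<open>A\<close> less those
  with a strictly larger star. Taking images under \<open>\<phi>\<close> matches the strict
  supersets on the two sides, so the subtracted sums agree.\<close>

lemma card_star_fibre_eq:
  assumes fin: "finite E" "finite E'" "\<And>e. e \<in> E \<Longrightarrow> finite e" "\<And>e. e \<in> E' \<Longrightarrow> finite e"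
    and bij: "bij_betw \<phi> E E'"
    and card: "\<And>A. \<lbrakk>A \<subseteq> E; A \<noteq> {}\<rbrakk> \<Longrightarrow> card (\<Inter> A) = card (\<Inter> (\<phi> ` A))"
    and A: "A \<subseteq> E" "A \<noteq> {}"
  shows "card {v. star E v = A} = card {v. star E' v = \<phi> ` A}"
  using A
proof (induction "card (E - A)" arbitrary: A rule: less_induct)
  case less
  let ?I = "{B. A \<subset> B \<and> B \<subseteq> E}" and ?J = "{B. \<phi> ` A \<subset> B \<and> B \<subseteq> E'}"
  have img: "\<phi> ` E = E'" and inj: "inj_on \<phi> E" using bij by (auto simp: bij_betw_def)
  have IH: "card {v. star E v = B} = card {v. star E' v = \<phi> ` B}" if "B \<in> ?I" for B
  proof (rule less.hyps)
    have "E - B \<subset> E - A" using that less.prems by blast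
    then show "card (E - B) < card (E - A)" using fin(1) by (simp add: psubset_card_mono)
  qed (use that in auto)
  have bijI: "bij_betw ((`) \<phi>) ?I ?J"
    unfolding bij_betw_def
  proof
    show "inj_on ((`) \<phi>) ?I"
      by (rule inj_on_subset[OF inj_on_image_Pow[OF inj]]) auto
    show "(`) \<phi> ` ?I = ?J"
    proof (intro equalityI subsetI)
      fix C assume "C \<in> (`) \<phi> ` ?I"
      then obtain B where B: "A \<subset> B" "B \<subseteq> E" "C = \<phi> ` B" by blast
      have "\<phi> ` A \<noteq> \<phi> ` B" using inj_on_image_eq_iff[OF inj] B less.prems by blast
      then show "C \<in> ?J" using B img by blast
    next
      fix C assume C: "C \<in> ?J"
      then have "C \<subseteq> \<phi> ` E" using img by blast
      then obtain B where B: "B \<subseteq> E" "C = \<phi> ` B" unfolding subset_image_iff by blast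
      have "A \<subseteq> B"
      proof
        fix a assume a: "a \<in> A"
        then have "\<phi> a \<in> \<phi> ` B" using B C by blast
        then show "a \<in> B" using inj_on_image_mem_iff[OF inj _ B(1)] a less.prems by blast
      qed
      then have "A \<subset> B" using B C by blast
      then show "C \<in> (`) \<phi> ` ?I" using B by blast
    qed
  qed
  have "card {v. star E v = A} + (\<Sum>B\<in>?I. card {v. star E v = B}) = card (\<Inter> A)"
    using card_Inter_eq_sum_stars[OF fin(1,3) less.prems] by simp
  also have "\<dots> = card (\<Inter> (\<phi> ` A))" using card less.prems by blast
  also have "\<dots> = card {v. star E' v = \<phi> ` A} + (\<Sum>B\<in>?J. card {v. star E' v = B})"
    by (rule card_Inter_eq_sum_stars) (use fin less.prems img in auto)
  also have "(\<Sum>B\<in>?J. card {v. star E' v = B}) = (\<Sum>B\<in>?I. card {v. star E v = B})"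
    using sum.reindex_bij_betw[OF bijI, of "\<lambda>B. card {v. star E' v = B}"] IH by simp
  finally show ?case by simp
qed

text \<open>Fibres of equal finite size admit bijections; these are glued by applying to each
  \<open>v\<close> the bijection chosen for its own label \<open>S v\<close>.\<close>

lemma bij_betw_of_card_fibres_eq:
  assumes "finite V" "finite V'"
    and "\<And>A. card {v \<in> V. S v = A} = card {v \<in> V'. S' v = A}"
  shows "\<exists>\<psi>. bij_betw \<psi> V V' \<and> (\<forall>v\<in>V. S' (\<psi> v) = S v)"
proof -
  have "\<forall>A. \<exists>h. bij_betw h {v \<in> V. S v = A} {v \<in> V'. S' v = A}"
    using assms by (auto intro!: finite_same_card_bij)
  then obtain h where h: "\<And>A. bij_betw (h A) {v \<in> V. S v = A} {v \<in> V'. S' v = A}"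
    by metis
  have mem: "h (S v) v \<in> V' \<and> S' (h (S v) v) = S v" if "v \<in> V" for v
    using bij_betwE[OF h[of "S v"]] that by blast
  have "bij_betw (\<lambda>v. h (S v) v) V V'"
    unfolding bij_betw_def
  proof
    show "inj_on (\<lambda>v. h (S v) v) V"
    proof (rule inj_onI)
      fix u v assume uv: "u \<in> V" "v \<in> V" "h (S u) u = h (S v) v"
      then have "S u = S v" using mem by metis
      then show "u = v"
        using uv inj_onD[OF bij_betw_imp_inj_on[OF h[of "S v"]], of u v] by simp
    qed
    show "(\<lambda>v. h (S v) v) ` V = V'"
    proof (intro equalityI subsetI)
      fix w assume "w \<in> V'"
      then have "w \<in> h (S' w) ` {v \<in> V. S v = S' w}"
        using bij_betw_imp_surj_on[OF h[of "S' w"]] by blast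
      then show "w \<in> (\<lambda>v. h (S v) v) ` V" by force
    qed (use mem in blast)
  qed
  with mem show ?thesis by blast
qed

lemma in_Union_if_star: "star E v \<noteq> {} \<Longrightarrow> v \<in> \<Union> E"
  by (auto simp: star_def)

text \<open>An edge containing two distinct vertices is the pair of them, so adjacency can be read
  off from stars alone.\<close>

lemma insert_in_iff_star_Int:
  assumes "\<And>e. e \<in> E \<Longrightarrow> card e = 2" "u \<noteq> v"
  shows "{u, v} \<in> E \<longleftrightarrow> star E u \<inter> star E v \<noteq> {}"
proof
  assume "star E u \<inter> star E v \<noteq> {}"
  then obtain e where e: "e \<in> E" "u \<in> e" "v \<in> e" by (auto simp: star_def)
  then have "{u, v} = e" using assms by (intro card_2_subset_eq) auto
  with e show "{u, v} \<in> E" by simp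
qed (auto simp: star_def)

text \<open>A result in the spirit of Whitney's theorem on edge isomorphisms. Pairwise intersections
  alone would confuse a triangle with a star of three edges; the condition on triples removes this
  exception.\<close>

lemma ex_vertex_bij_of_edge_bij:
  assumes fin: "finite E" "finite E'"
    and pairs: "\<And>e. e \<in> E \<Longrightarrow> card e = 2" "\<And>e. e \<in> E' \<Longrightarrow> card e = 2"
    and bij: "bij_betw \<phi> E E'"
    and triple: "\<And>e f g. \<lbrakk>e \<in> E; f \<in> E; g \<in> E\<rbrakk> \<Longrightarrow>
                   e \<inter> f \<inter> g = {} \<longleftrightarrow> \<phi> e \<inter> \<phi> f \<inter> \<phi> g = {}"
  shows "\<exists>\<psi>. bij_betw \<psi> (\<Union> E) (\<Union> E') \<and>
    (\<forall>u\<in>\<Union> E. \<forall>v\<in>\<Union> E. u \<noteq> v \<longrightarrow> ({u, v} \<in> E \<longleftrightarrow> {\<psi> u, \<psi> v} \<in> E'))"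
proof -
  have img: "\<phi> ` E = E'" and inj: "inj_on \<phi> E" using bij by (auto simp: bij_betw_def)
  have fine: "finite e" if "e \<in> E" for e using pairs(1)[OF that] card.infinite by fastforce
  have fine': "finite e" if "e \<in> E'" for e using pairs(2)[OF that] card.infinite by fastforce
  have card: "card (\<Inter> A) = card (\<Inter> (\<phi> ` A))" if "A \<subseteq> E" "A \<noteq> {}" for A
    by (rule card_Inter_image_eq[OF pairs(1) _ inj triple that]) (use img pairs in auto)
  \<comment> \<open>Vertices of \<open>E\<close> are labelled by their stars transported along
    \<open>\<phi>\<close>, so that both sides carry labels among the subsets of
    \<open>E'\<close>.\<close>
  have fib: "card {v \<in> \<Union> E. \<phi> ` star E v = A} = card {v \<in> \<Union> E'. star E' v = A}" for A
  proof (cases "A \<subseteq> E' \<and> A \<noteq> {}")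
    case True
    then have "A \<subseteq> \<phi> ` E" "A \<noteq> {}" using img by auto
    then obtain B where B: "B \<subseteq> E" "A = \<phi> ` B" "B \<noteq> {}"
      unfolding subset_image_iff by blast
    have s: "star E v \<subseteq> E" for v by (auto simp: star_def)
    have "\<phi> ` star E v = A \<longleftrightarrow> star E v = B" for v
      using inj_on_image_eq_iff[OF inj s B(1)] B by simp
    then have "{v \<in> \<Union> E. \<phi> ` star E v = A} = {v. star E v = B}"
      using in_Union_if_star B(3) by fastforce
    moreover have "{v \<in> \<Union> E'. star E' v = A} = {v. star E' v = \<phi> ` B}"
      using in_Union_if_star B True by fastforce
    ultimately show ?thesis
      using card_star_fibre_eq[OF fin fine fine' bij card B(1,3)] by simp
  next
    \<comment> \<open>The remaining labels are the empty set and sets not contained in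
      \<open>E'\<close>; neither occurs at a non-isolated vertex, so both fibres are empty.\<close>
    case False
    have "\<phi> ` star E v \<noteq> A" if "v \<in> \<Union> E" for v using False img that by (auto simp: star_def)
    then have 1: "{v \<in> \<Union> E. \<phi> ` star E v = A} = {}" by blast
    have "star E' v \<noteq> A" if "v \<in> \<Union> E'" for v using False that by (auto simp: star_def)
    then have 2: "{v \<in> \<Union> E'. star E' v = A} = {}" by blast
    show ?thesis unfolding 1 2 by simp
  qed
  have "finite (\<Union> E)" "finite (\<Union> E')" using fin fine fine' by auto
  from bij_betw_of_card_fibres_eq[OF this fib]
  obtain \<psi> where \<psi>: "bij_betw \<psi> (\<Union> E) (\<Union> E')" "\<forall>v\<in>\<Union> E. star E' (\<psi> v) = \<phi> ` star E v"
    by blast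
  have "{u, v} \<in> E \<longleftrightarrow> {\<psi> u, \<psi> v} \<in> E'" if uv: "u \<in> \<Union> E" "v \<in> \<Union> E" "u \<noteq> v" for u v
  proof -
    have "\<psi> u \<noteq> \<psi> v" using \<psi>(1) uv by (auto simp: bij_betw_def dest: inj_onD)
    then have "{\<psi> u, \<psi> v} \<in> E' \<longleftrightarrow> \<phi> ` star E u \<inter> \<phi> ` star E v \<noteq> {}"
      using insert_in_iff_star_Int[of E', OF pairs(2)] bspec[OF \<psi>(2) uv(1)] bspec[OF \<psi>(2) uv(2)]
      by simp
    also have "\<phi> ` star E u \<inter> \<phi> ` star E v = \<phi> ` (star E u \<inter> star E v)"
      by (rule inj_on_image_Int[OF inj, symmetric]) (auto simp: star_def)
    finally show ?thesis using insert_in_iff_star_Int[of E, OF pairs(1)] uv by simp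
  qed
  with \<psi>(1) show ?thesis by blast
qed

section \<open>Reconstruction from transitive edge sets\<close>

lemma card_2_otherE:
  assumes "card e = 2" "v \<in> e"
  obtains x where "e = {v, x}" "x \<noteq> v"
proof -
  obtain x y where xy: "e = {x, y}" "x \<noteq> y" using assms(1) by (auto simp: card_2_iff)
  then consider "v = x" | "v = y" using assms(2) by blast
  then show ?thesis
  proof cases
    case 1
    with xy that[of y] show ?thesis by blast
  next
    case 2
    with xy that[of x] show ?thesis by blast
  qed
qed

lemma adjacent_pairsE:
  assumes "card e = 2" "card f = 2" "e \<noteq> f" "e \<inter> f \<noteq> {}"
  obtains x y z where "e = {x, y}" "f = {y, z}" "x \<noteq> y" "y \<noteq> z" "x \<noteq> z"
proof -
  obtain y where y: "y \<in> e" "y \<in> f" using assms(4) by blast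
  obtain x where x: "e = {y, x}" "x \<noteq> y" using card_2_otherE[OF assms(1) y(1)] by blast
  obtain z where z: "f = {y, z}" "z \<noteq> y" using card_2_otherE[OF assms(2) y(2)] by blast
  have "x \<noteq> z" using assms(3) x z by blast
  then show ?thesis using that[of x y z] x z by (simp add: insert_commute)
qed

lemma sym_diff_subset_cluster:
  assumes "F \<in> cluster_edges E" "F' \<in> cluster_edges E"
  shows "sym_diff F F' \<subseteq> E"
  using assms unfolding cluster_edges_def by blast

lemma card_Inter_sym_diff_eq_2_iff:
  assumes "\<And>e. e \<in> E \<Longrightarrow> card e = 2" "F \<in> cluster_edges E" "F' \<in> cluster_edges E" "F \<noteq> F'"
  shows "card (\<Inter> (sym_diff F F')) = 2 \<longleftrightarrow> (\<exists>e\<in>E. sym_diff F F' = {e})"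
proof -
  have sub: "sym_diff F F' \<subseteq> E" using sym_diff_subset_cluster assms(2,3) by blast
  have "card (\<Inter> (sym_diff F F')) = 2 \<longleftrightarrow> (\<exists>e. sym_diff F F' = {e})"
    by (rule card_Inter_eq_2_iff) (use assms(1,4) sub in auto)
  with sub show ?thesis by (metis insert_subset)
qed

section \<open>Recognising intersection patterns from multiplicities\<close>

text \<open>Disjoint \<open>e\<close> and \<open>f\<close> give \<open>{e}\<close> and
  \<open>{f}\<close> a second common neighbour by double edges besides \<open>{}\<close>, namely
  \<open>{e, f}\<close>. No other set can serve, and \<open>{e, f}\<close> is not transitive when
  the two pairs meet. \<open>F\<close> avoids \<open>{e}\<close> and \<open>{f}\<close> because an
  empty symmetric difference has intersection \<open>UNIV\<close>.\<close>

lemma disjoint_iff_ex_cluster: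
  assumes pairs: "\<And>e. e \<in> E \<Longrightarrow> card e = 2" and ef: "e \<in> E" "f \<in> E" "e \<noteq> f"
  shows "e \<inter> f = {} \<longleftrightarrow>
    (\<exists>F\<in>cluster_edges E. F \<notin> {{}, {e}, {f}} \<and>
       card (\<Inter> (sym_diff {e} F)) = 2 \<and> card (\<Inter> (sym_diff {f} F)) = 2)"
    (is "_ \<longleftrightarrow> ?R")
proof
  assume dis: "e \<inter> f = {}"
  have "{x, z} \<in> {e, f}" if "{x, y} \<in> {e, f}" "{y, z} \<in> {e, f}" "x \<noteq> z" for x y z
  proof -
    have ne: "x \<noteq> y" using that(1) pairs ef by force
    have "{x, y} = {y, z}" using that(1,2) dis by blast
    then show ?thesis using ne that(3) by blast
  qed
  then have "{e, f} \<in> cluster_edges E" using ef unfolding cluster_edges_def by blast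
  moreover have "sym_diff {e} {e, f} = {f}" "sym_diff {f} {e, f} = {e}" using ef(3) by auto
  ultimately show ?R
    using pairs ef by (intro bexI[of _ "{e, f}"]) auto
next
  assume ?R
  then obtain F where F: "F \<in> cluster_edges E" "F \<noteq> {}" "F \<noteq> {e}" "F \<noteq> {f}"
    "card (\<Inter> (sym_diff {e} F)) = 2" "card (\<Inter> (sym_diff {f} F)) = 2" by blast
  obtain a where a: "sym_diff {e} F = {a}"
    using card_Inter_sym_diff_eq_2_iff[OF pairs singleton_in_cluster_edges[OF ef(1) pairs] F(1)] F ef
    by blast
  obtain b where b: "sym_diff {f} F = {b}"
    using card_Inter_sym_diff_eq_2_iff[OF pairs singleton_in_cluster_edges[OF ef(2) pairs] F(1)] F ef
    by blast
  \<comment> \<open>Otherwise the symmetric difference is \<open>insert e F\<close>, and as a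
    singleton it leaves only the excluded cases \<open>F = {}\<close> and
    \<open>F = {e}\<close>.\<close>
  have e: "e \<in> F"
  proof (rule ccontr)
    assume "e \<notin> F"
    then have "insert e F = {a}" using a by auto
    then show False using F(2,3) by blast
  qed
  have f: "f \<in> F"
  proof (rule ccontr)
    assume "f \<notin> F"
    then have "insert f F = {b}" using b by auto
    then show False using F(2,4) by blast
  qed
  have F_eq: "F = {e, f}" using a e f ef(3) by blast
  show "e \<inter> f = {}"
  proof (rule ccontr)
    assume "e \<inter> f \<noteq> {}"
    then obtain x y z where xyz: "e = {x, y}" "f = {y, z}" "x \<noteq> y" "y \<noteq> z" "x \<noteq> z"
      using adjacent_pairsE[OF pairs[OF ef(1)] pairs[OF ef(2)] ef(3)] by blast
    have "{x, z} \<in> F" using cluster_edgesD[OF F(1)] e f xyz by blast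
    then show False using F_eq xyz by (auto simp: doubleton_eq_iff)
  qed
qed

text \<open>This separates triangles from stars. A triangle is itself a transitive set not joined to
  \<open>{}\<close> but joined to each of its three singletons. In a star, a set \<open>F\<close>
  with these properties would contain \<open>e\<close>, \<open>f\<close>, \<open>g\<close> and by
  transitivity the pairs closing them up; then \<open>F\<close> differs from \<open>{e}\<close> in
  two disjoint pairs and is not joined to it.\<close>

lemma Int3_empty_iff_ex_cluster:
  assumes pairs: "\<And>e. e \<in> E \<Longrightarrow> card e = 2"
    and E: "e \<in> E" "f \<in> E" "g \<in> E" and neq: "e \<noteq> f" "f \<noteq> g" "e \<noteq> g"
    and meet: "e \<inter> f \<noteq> {}" "f \<inter> g \<noteq> {}" "e \<inter> g \<noteq> {}"
  shows "e \<inter> f \<inter> g = {} \<longleftrightarrow>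
    (\<exists>F\<in>cluster_edges E. F \<notin> {{}, {e}, {f}, {g}} \<and> card (\<Inter> (sym_diff {} F)) = 0 \<and>
       (\<forall>h\<in>{e, f, g}. card (\<Inter> (sym_diff {h} F)) \<noteq> 0))"
    (is "_ \<longleftrightarrow> ?R")
proof
  assume dis: "e \<inter> f \<inter> g = {}"
  obtain x y z where xyz: "e = {x, y}" "f = {y, z}" "x \<noteq> y" "y \<noteq> z" "x \<noteq> z"
    using adjacent_pairsE[OF pairs[OF E(1)] pairs[OF E(2)] neq(1) meet(1)] by blast
  have "{x, z} \<subseteq> g" using dis meet xyz by blast
  then have g: "g = {x, z}"
    using card_2_subset_eq[of "{x, z}" g] pairs[OF E(3)] xyz(5) by simp
  let ?F = "{{x, y}, {y, z}, {x, z}}"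
  \<comment> \<open>Expressing membership in the triangle through the endpoints makes its
    transitivity immediate.\<close>
  have mem: "{a, b} \<in> ?F \<longleftrightarrow> a \<noteq> b \<and> a \<in> {x, y, z} \<and> b \<in> {x, y, z}" for a b
    using xyz(3-5) by (simp add: doubleton_eq_iff) blast
  have "?F \<in> cluster_edges E"
    unfolding cluster_edges_def mem_Collect_eq mem using E xyz g by blast
  moreover have "?F \<notin> {{}, {e}, {f}, {g}}" using neq unfolding xyz(1,2) g by blast
  moreover have "\<Inter> (sym_diff {} ?F) = {}" using xyz(3-5) by auto
  moreover have "sym_diff {e} ?F = {{y, z}, {x, z}}" "sym_diff {f} ?F = {{x, y}, {x, z}}"
    "sym_diff {g} ?F = {{x, y}, {y, z}}"
    using neq unfolding xyz(1,2) g by blast+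
  moreover have "\<Inter> {{y, z}, {x, z}} = {z}" "\<Inter> {{x, y}, {x, z}} = {x}" "\<Inter> {{x, y}, {y, z}} = {y}"
    using xyz(3-5) by auto
  ultimately show ?R
    by (intro bexI[of _ ?F]) (simp_all del: Inter_insert)
next
  assume ?R
  then obtain F where F: "F \<in> cluster_edges E" "F \<noteq> {}" "card (\<Inter> F) = 0"
    and Fh: "\<And>h. h \<in> {e, f, g} \<Longrightarrow> F \<noteq> {h}"
      "\<And>h. h \<in> {e, f, g} \<Longrightarrow> card (\<Inter> (sym_diff {h} F)) \<noteq> 0"
    by auto
  have FE: "F \<subseteq> E" using F(1) by (simp add: cluster_edges_def)
  have "\<Inter> F = {}" using card_Inter_eq_0_iff[of F] F FE pairs by blast
  \<comment> \<open>If \<open>h\<close> were missing, the symmetric difference with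
    \<open>{h}\<close> would contain all of \<open>F\<close>, whose intersection is already
    empty.\<close>
  have inF: "h \<in> F" if "h \<in> {e, f, g}" for h
  proof (rule ccontr)
    assume "h \<notin> F"
    then have "\<Inter> (sym_diff {h} F) \<subseteq> \<Inter> F" by blast
    then show False using \<open>\<Inter> F = {}\<close> Fh(2)[OF that] by simp
  qed
  show "e \<inter> f \<inter> g = {}"
  proof (rule ccontr)
    assume "e \<inter> f \<inter> g \<noteq> {}"
    then obtain a where a: "a \<in> e" "a \<in> f" "a \<in> g" by blast
    obtain b where b: "e = {a, b}" "b \<noteq> a" using card_2_otherE[OF pairs[OF E(1)] a(1)] by blast
    obtain c where c: "f = {a, c}" "c \<noteq> a" using card_2_otherE[OF pairs[OF E(2)] a(2)] by blast
    obtain d where d: "g = {a, d}" "d \<noteq> a" using card_2_otherE[OF pairs[OF E(3)] a(3)] by blast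
    have ne: "b \<noteq> c" "b \<noteq> d" "c \<noteq> d" using neq b c d by auto
    have "{b, a} \<in> F" using inF[of e] b by (simp add: insert_commute)
    moreover have "{a, d} \<in> F" using inF[of g] d by simp
    ultimately have "{b, d} \<in> F" using cluster_edgesD[OF F(1)] ne(2) by blast
    moreover have "{a, c} \<in> F" using inF[of f] c by simp
    ultimately have "\<Inter> (sym_diff {e} F) \<subseteq> {b, d} \<inter> {a, c}"
      using b c d ne by (auto simp: doubleton_eq_iff)
    also have "\<dots> = {}" using b c d ne by auto
    finally show False using Fh(2)[of e] by simp
  qed
qed

text \<open>The singletons are exactly the neighbours of \<open>{}\<close> by double edges, so
  \<open>h\<close> permutes them into the singletons over \<open>E'\<close> and thereby defines
  \<open>\<phi>\<close>. Both recognition criteria mention only multiplicities, \<open>{}\<close>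
  and singletons, hence they transfer along \<open>h\<close>.\<close>

lemma ex_edge_bij_of_cluster_bij:
  assumes pairs: "\<And>e. e \<in> E \<Longrightarrow> card e = 2" "\<And>e. e \<in> E' \<Longrightarrow> card e = 2"
    and bij: "bij_betw h (cluster_edges E) (cluster_edges E')"
    and mult: "\<And>F F'. \<lbrakk>F \<in> cluster_edges E; F' \<in> cluster_edges E; F \<noteq> F'\<rbrakk> \<Longrightarrow>
                 card (\<Inter> (sym_diff (h F) (h F'))) = card (\<Inter> (sym_diff F F'))"
    and h0: "h {} = {}"
  shows "\<exists>\<phi>. bij_betw \<phi> E E' \<and>
    (\<forall>e\<in>E. \<forall>f\<in>E. \<forall>g\<in>E. e \<inter> f \<inter> g = {} \<longleftrightarrow> \<phi> e \<inter> \<phi> f \<inter> \<phi> g = {})"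
proof -
  let ?X = "cluster_edges E" and ?X' = "cluster_edges E'"
  have hX: "h F \<in> ?X'" if "F \<in> ?X" for F using bij that by (rule bij_betw_apply)
  have h_eq: "h F = h F' \<longleftrightarrow> F = F'" if "F \<in> ?X" "F' \<in> ?X" for F F'
    using bij that by (auto simp: bij_betw_def dest: inj_onD)
  have sing: "{e} \<in> ?X" if "e \<in> E" for e using singleton_in_cluster_edges that pairs(1) by blast
  have sing': "{e} \<in> ?X'" if "e \<in> E'" for e using singleton_in_cluster_edges that pairs(2) by blast
  have "\<exists>e'\<in>E'. h {e} = {e'}" if "e \<in> E" for e
  proof -
    have "card (\<Inter> (sym_diff {} (h {e}))) = 2"
      using mult[OF empty_in_cluster_edges sing[OF that]] pairs(1)[OF that] h0 by simp
    moreover have "{} \<noteq> h {e}"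
      using h_eq[OF empty_in_cluster_edges sing[OF that]] h0 by simp
    ultimately show ?thesis
      using card_Inter_sym_diff_eq_2_iff[OF pairs(2) empty_in_cluster_edges hX[OF sing[OF that]]]
      by simp
  qed
  then obtain \<phi> where \<phi>: "\<And>e. e \<in> E \<Longrightarrow> \<phi> e \<in> E' \<and> h {e} = {\<phi> e}" by metis
  have inj: "inj_on \<phi> E"
  proof (rule inj_onI)
    fix e f assume "e \<in> E" "f \<in> E" "\<phi> e = \<phi> f"
    then have "h {e} = h {f}" using \<phi> by simp
    then show "e = f" using h_eq[OF sing sing] \<open>e \<in> E\<close> \<open>f \<in> E\<close> by blast
  qed
  have surj: "\<phi> ` E = E'"
  proof (intro equalityI subsetI)
    fix e' assume e': "e' \<in> E'"
    then obtain F where F: "F \<in> ?X" "h F = {e'}"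
      using sing' bij unfolding bij_betw_def by (metis imageE)
    have ne: "{} \<noteq> F" using F h0 by auto
    have "card (\<Inter> (sym_diff {} F)) = 2"
      using mult[OF empty_in_cluster_edges F(1) ne] F(2) pairs(2)[OF e'] h0 by simp
    then obtain e where "e \<in> E" "F = {e}"
      using card_Inter_sym_diff_eq_2_iff[OF pairs(1) empty_in_cluster_edges F(1) ne] by auto
    then show "e' \<in> \<phi> ` E" using F(2) \<phi> by auto
  qed (use \<phi> in auto)
  \<comment> \<open>Surjectivity of \<open>h\<close> turns a criterion over \<open>E'\<close> into
    one about \<open>h F\<close> with \<open>F\<close> over \<open>E\<close>.\<close>
  have ex: "(\<exists>F\<in>?X'. Q F) \<longleftrightarrow> (\<exists>F\<in>?X. Q (h F))" for Q
    using bij unfolding bij_betw_def by (metis (no_types, lifting) image_iff)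
  have cond: "h F = {\<phi> e} \<longleftrightarrow> F = {e}" if "F \<in> ?X" "e \<in> E" for F e
    using h_eq[OF that(1) sing[OF that(2)]] \<phi>[OF that(2)] by simp
  have cond0: "h F = {} \<longleftrightarrow> F = {}" if "F \<in> ?X" for F
    using h_eq[OF that empty_in_cluster_edges] h0 by simp
  have m: "card (\<Inter> (sym_diff {\<phi> e} (h F))) = card (\<Inter> (sym_diff {e} F))"
    if "F \<in> ?X" "e \<in> E" "F \<noteq> {e}" for F e
    using mult[OF sing[OF that(2)] that(1)] that(3) \<phi>[OF that(2)] by metis
  have m0: "card (\<Inter> (sym_diff {} (h F))) = card (\<Inter> (sym_diff {} F))" if "F \<in> ?X" "F \<noteq> {}" for F
    using mult[OF empty_in_cluster_edges that(1)] that(2) h0 by metis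
  have two: "\<phi> e \<inter> \<phi> f = {} \<longleftrightarrow> e \<inter> f = {}" if ef: "e \<in> E" "f \<in> E" for e f
  proof (cases "e = f")
    case True
    then show ?thesis using pairs \<phi>[OF ef(1)] ef by (metis Int_absorb card.empty zero_neq_numeral)
  next
    case False
    have ne: "\<phi> e \<noteq> \<phi> f" using inj ef False by (auto dest: inj_onD)
    have "\<phi> e \<inter> \<phi> f = {} \<longleftrightarrow> (\<exists>F\<in>?X'. F \<notin> {{}, {\<phi> e}, {\<phi> f}} \<and>
       card (\<Inter> (sym_diff {\<phi> e} F)) = 2 \<and> card (\<Inter> (sym_diff {\<phi> f} F)) = 2)"
      by (rule disjoint_iff_ex_cluster) (use pairs \<phi> ef ne in auto)
    also have "\<dots> \<longleftrightarrow> (\<exists>F\<in>?X. F \<notin> {{}, {e}, {f}} \<and>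
       card (\<Inter> (sym_diff {e} F)) = 2 \<and> card (\<Inter> (sym_diff {f} F)) = 2)"
      unfolding ex
    proof (rule bex_cong[OF refl])
      fix F assume F: "F \<in> ?X"
      show "(h F \<notin> {{}, {\<phi> e}, {\<phi> f}} \<and>
          card (\<Inter> (sym_diff {\<phi> e} (h F))) = 2 \<and> card (\<Inter> (sym_diff {\<phi> f} (h F))) = 2) \<longleftrightarrow>
        (F \<notin> {{}, {e}, {f}} \<and>
          card (\<Inter> (sym_diff {e} F)) = 2 \<and> card (\<Inter> (sym_diff {f} F)) = 2)"
        using cond[OF F] cond0[OF F] m[OF F] ef by (metis insert_iff singletonD)
    qed
    also have "\<dots> \<longleftrightarrow> e \<inter> f = {}"
      by (rule disjoint_iff_ex_cluster[symmetric]) (use pairs ef False in auto)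
    finally show ?thesis .
  qed
  have three: "e \<inter> f \<inter> g = {} \<longleftrightarrow> \<phi> e \<inter> \<phi> f \<inter> \<phi> g = {}"
    if E: "e \<in> E" "f \<in> E" "g \<in> E" for e f g
  proof -
    \<comment> \<open>Repeated or disjoint edges reduce to the statement on two edges; only three
      distinct, pairwise meeting edges need the triangle criterion.\<close>
    consider "e = f \<or> f = g \<or> e = g" | "e \<inter> f = {} \<or> f \<inter> g = {} \<or> e \<inter> g = {}"
      | "e \<noteq> f" "f \<noteq> g" "e \<noteq> g" "e \<inter> f \<noteq> {}" "f \<inter> g \<noteq> {}" "e \<inter> g \<noteq> {}"
      by blast
    then show ?thesis
    proof cases
      case 1
      then have "(e \<inter> f \<inter> g = e \<inter> g \<and> \<phi> e \<inter> \<phi> f \<inter> \<phi> g = \<phi> e \<inter> \<phi> g) \<or>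
        (e \<inter> f \<inter> g = e \<inter> f \<and> \<phi> e \<inter> \<phi> f \<inter> \<phi> g = \<phi> e \<inter> \<phi> f)" by blast
      then show ?thesis using two E by metis
    next
      case 2
      then have "\<phi> e \<inter> \<phi> f = {} \<or> \<phi> f \<inter> \<phi> g = {} \<or> \<phi> e \<inter> \<phi> g = {}" using two E by blast
      with 2 have "e \<inter> f \<inter> g = {}" "\<phi> e \<inter> \<phi> f \<inter> \<phi> g = {}" by auto
      then show ?thesis by simp
    next
      case 3
      have ne: "\<phi> e \<noteq> \<phi> f" "\<phi> f \<noteq> \<phi> g" "\<phi> e \<noteq> \<phi> g" using inj E 3 by (auto dest: inj_onD)
      have meet: "\<phi> e \<inter> \<phi> f \<noteq> {}" "\<phi> f \<inter> \<phi> g \<noteq> {}" "\<phi> e \<inter> \<phi> g \<noteq> {}"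
        using two E 3 by simp_all
      have E': "\<phi> e \<in> E'" "\<phi> f \<in> E'" "\<phi> g \<in> E'" using \<phi> E by auto
      have "\<phi> e \<inter> \<phi> f \<inter> \<phi> g = {} \<longleftrightarrow>
        (\<exists>F\<in>?X'. F \<notin> {{}, {\<phi> e}, {\<phi> f}, {\<phi> g}} \<and> card (\<Inter> (sym_diff {} F)) = 0 \<and>
           (\<forall>k\<in>{\<phi> e, \<phi> f, \<phi> g}. card (\<Inter> (sym_diff {k} F)) \<noteq> 0))"
        by (rule Int3_empty_iff_ex_cluster[OF pairs(2) E' ne meet])
      also have "\<dots> \<longleftrightarrow>
        (\<exists>F\<in>?X. F \<notin> {{}, {e}, {f}, {g}} \<and> card (\<Inter> (sym_diff {} F)) = 0 \<and>
           (\<forall>k\<in>{e, f, g}. card (\<Inter> (sym_diff {k} F)) \<noteq> 0))"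
        unfolding ex
      proof (rule bex_cong[OF refl])
        fix F assume F: "F \<in> ?X"
        have A: "h F \<notin> {{}, {\<phi> e}, {\<phi> f}, {\<phi> g}} \<longleftrightarrow> F \<notin> {{}, {e}, {f}, {g}}"
          using cond[OF F E(1)] cond[OF F E(2)] cond[OF F E(3)] cond0[OF F] by simp
        \<comment> \<open>Multiplicities are preserved only between distinct sets, hence the
          restriction on \<open>F\<close>.\<close>
        have B: "card (\<Inter> (sym_diff {} (h F))) = card (\<Inter> (sym_diff {} F))"
          "\<And>k. k \<in> {e, f, g} \<Longrightarrow>
             card (\<Inter> (sym_diff {\<phi> k} (h F))) = card (\<Inter> (sym_diff {k} F))"
          if "F \<notin> {{}, {e}, {f}, {g}}"
          using m0[OF F] m[OF F] E that by blast+
        have "(\<forall>k\<in>{\<phi> e, \<phi> f, \<phi> g}. card (\<Inter> (sym_diff {k} (h F))) \<noteq> 0) \<longleftrightarrow>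
              (\<forall>k\<in>{e, f, g}. card (\<Inter> (sym_diff {\<phi> k} (h F))) \<noteq> 0)" by blast
        then show "(h F \<notin> {{}, {\<phi> e}, {\<phi> f}, {\<phi> g}} \<and> card (\<Inter> (sym_diff {} (h F))) = 0 \<and>
           (\<forall>k\<in>{\<phi> e, \<phi> f, \<phi> g}. card (\<Inter> (sym_diff {k} (h F))) \<noteq> 0)) \<longleftrightarrow>
          (F \<notin> {{}, {e}, {f}, {g}} \<and> card (\<Inter> (sym_diff {} F)) = 0 \<and>
           (\<forall>k\<in>{e, f, g}. card (\<Inter> (sym_diff {k} F)) \<noteq> 0))"
          unfolding A using B by metis
      qed
      also have "\<dots> \<longleftrightarrow> e \<inter> f \<inter> g = {}"
        by (rule Int3_empty_iff_ex_cluster[OF pairs(1) E 3, symmetric])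
      finally show ?thesis by blast
    qed
  qed
  show ?thesis using inj surj three unfolding bij_betw_def by blast
qed

section \<open>Moving the empty edge set to the empty edge set\<close>

text \<open>Let \<open>e = {x, y}\<close> in \<open>M\<close> meet \<open>f = {y, z}\<close>. If
  \<open>f\<close> is in \<open>M\<close>, so is \<open>{x, z}\<close>, and removing
  \<open>f\<close> leaves the path y-x-z unclosed. If \<open>f\<close> is not in \<open>M\<close>,
  adding it forces \<open>{x, z}\<close> into \<open>M\<close>, and then the path y-x-z forces
  \<open>f\<close> into \<open>M\<close>.\<close>

lemma isolated_if_all_toggles_cluster:
  assumes pairs: "\<And>e. e \<in> E \<Longrightarrow> card e = 2"
    and M: "M \<in> cluster_edges E" "\<And>e. e \<in> E \<Longrightarrow> sym_diff M {e} \<in> cluster_edges E"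
    and ef: "e \<in> M" "f \<in> E" "e \<noteq> f"
  shows "e \<inter> f = {}"
proof (rule ccontr)
  assume meet: "e \<inter> f \<noteq> {}"
  have "e \<in> E" using M(1) ef(1) unfolding cluster_edges_def by blast
  then obtain x y z where xyz: "e = {x, y}" "f = {y, z}" "x \<noteq> y" "y \<noteq> z" "x \<noteq> z"
    using adjacent_pairsE[OF pairs pairs[OF ef(2)] ef(3) meet] by blast
  have ne: "{x, z} \<noteq> e" "{x, z} \<noteq> f" using xyz by (auto simp: doubleton_eq_iff)
  show False
  proof (cases "f \<in> M")
    case True
    then have xz: "{x, z} \<in> M" using cluster_edgesD[OF M(1)] ef xyz by blast
    have "{y, x} \<in> sym_diff M {f}" using ef xyz by (auto simp: insert_commute)
    moreover have "{x, z} \<in> sym_diff M {f}" using xz ne by blast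
    ultimately have "f \<in> sym_diff M {f}" using cluster_edgesD[OF M(2)[OF ef(2)]] xyz by blast
    then show False using True by blast
  next
    case False
    have "{x, y} \<in> sym_diff M {f}" using ef xyz by blast
    moreover have "{y, z} \<in> sym_diff M {f}" using False xyz by blast
    ultimately have "{x, z} \<in> sym_diff M {f}" using cluster_edgesD[OF M(2)[OF ef(2)]] xyz(5) by blast
    then have "{x, z} \<in> M" using ne by blast
    moreover have "{y, x} \<in> M" using ef xyz by (simp add: insert_commute)
    ultimately have "f \<in> M" using cluster_edgesD[OF M(1)] xyz by blast
    then show False using False by blast
  qed
qed

text \<open>A pair of \<open>M\<close> meets no other pair of \<open>E\<close>, so it takes part in
  no instance of transitivity and can be toggled freely.\<close>

lemma sym_diff_isolated_cluster:
  assumes pairs: "\<And>e. e \<in> E \<Longrightarrow> card e = 2"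
    and F: "F \<in> cluster_edges E" and M: "M \<subseteq> E"
    and isol: "\<And>e f. \<lbrakk>e \<in> M; f \<in> E; e \<noteq> f\<rbrakk> \<Longrightarrow> e \<inter> f = {}"
  shows "sym_diff F M \<in> cluster_edges E"
proof -
  have FE: "F \<subseteq> E" using F by (simp add: cluster_edges_def)
  have "{x, z} \<in> sym_diff F M"
    if A: "{x, y} \<in> sym_diff F M" "{y, z} \<in> sym_diff F M" and "x \<noteq> z" for x y z
  proof -
    have inE: "{x, y} \<in> E" "{y, z} \<in> E" using A FE M by blast+
    have ne: "x \<noteq> y" using pairs[OF inE(1)] by auto
    have neq: "{x, y} \<noteq> {y, z}" using ne \<open>x \<noteq> z\<close> by (auto simp: doubleton_eq_iff)
    have notM: "{x, y} \<notin> M" "{y, z} \<notin> M"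
      using isol[OF _ inE(2) neq] isol[OF _ inE(1) neq[symmetric]] by blast+
    then have "{x, z} \<in> F" using A cluster_edgesD[OF F _ _ \<open>x \<noteq> z\<close>] by blast
    moreover have "{x, z} \<notin> M"
    proof
      assume "{x, z} \<in> M"
      moreover from this have "{x, z} \<noteq> {x, y}" using notM by metis
      ultimately show False using isol inE(1) by blast
    qed
    ultimately show ?thesis by blast
  qed
  then show ?thesis using FE M unfolding cluster_edges_def by blast
qed

text \<open>The singletons provide \<open>card E\<close> double edges at \<open>{}\<close>. Their
  images are neighbours of \<open>h {}\<close> by double edges, hence arise from \<open>h {}\<close>
  by toggling one of the \<open>card E'\<close> pairs of \<open>E'\<close>. If the numbers agree,
  every toggle occurs as an image and is therefore transitive.\<close>

lemma cluster_bij_image_empty: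
  assumes fin: "finite E'"
    and pairs: "\<And>e. e \<in> E \<Longrightarrow> card e = 2" "\<And>e. e \<in> E' \<Longrightarrow> card e = 2"
    and bij: "bij_betw h (cluster_edges E) (cluster_edges E')"
    and mult: "\<And>F F'. \<lbrakk>F \<in> cluster_edges E; F' \<in> cluster_edges E; F \<noteq> F'\<rbrakk> \<Longrightarrow>
                 card (\<Inter> (sym_diff (h F) (h F'))) = card (\<Inter> (sym_diff F F'))"
  shows "card E \<le> card E'"
    and "\<lbrakk>card E = card E'; e' \<in> E'\<rbrakk> \<Longrightarrow> sym_diff (h {}) {e'} \<in> cluster_edges E'"
proof -
  let ?N = "(\<lambda>e. h {e}) ` E" and ?T = "(\<lambda>e. sym_diff (h {}) {e}) ` E'"
  have sing: "{e} \<in> cluster_edges E" if "e \<in> E" for e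
    using singleton_in_cluster_edges that pairs(1) by blast
  have inj: "inj_on h (cluster_edges E)" using bij by (rule bij_betw_imp_inj_on)
  have "inj_on (\<lambda>e. h {e}) E"
    by (rule inj_onI) (use inj_onD[OF inj _ sing sing] in blast)
  then have cN: "card ?N = card E" by (rule card_image)
  have NX: "?N \<subseteq> cluster_edges E'" using bij_betw_apply[OF bij] sing by blast
  have "inj_on (\<lambda>e. sym_diff (h {}) {e}) E'"
    by (rule inj_onI) blast
  then have cT: "card ?T = card E'" by (rule card_image)
  have NT: "?N \<subseteq> ?T"
  proof
    fix K assume "K \<in> ?N"
    then obtain e where e: "e \<in> E" "K = h {e}" by blast
    have ne: "h {} \<noteq> K"
      using inj_onD[OF inj _ empty_in_cluster_edges sing[OF e(1)]] e(2) by blast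
    have "card (\<Inter> (sym_diff (h {}) K)) = 2"
      using mult[OF empty_in_cluster_edges sing[OF e(1)]] pairs(1)[OF e(1)] e(2) by simp
    then obtain e' where e': "e' \<in> E'" "sym_diff (h {}) K = {e'}"
      using card_Inter_sym_diff_eq_2_iff[OF pairs(2) _ _ ne] bij_betw_apply[OF bij]
        empty_in_cluster_edges[of E] sing[OF e(1)] e(2) by blast
    have "K = sym_diff (h {}) {e'}" using e'(2) by blast
    then show "K \<in> ?T" using e'(1) by blast
  qed
  show "card E \<le> card E'" using card_mono[OF _ NT] fin cN cT by simp
  assume eq: "card E = card E'" and e': "e' \<in> E'"
  have "?N = ?T" using card_subset_eq[OF _ NT] fin cN cT eq by simp
  moreover have "sym_diff (h {}) {e'} \<in> ?T" using e' by (rule imageI)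
  ultimately show "sym_diff (h {}) {e'} \<in> cluster_edges E'" using NX by (metis (no_types) subsetD)
qed

lemma ex_vertex_bij_of_cluster_bij:
  assumes fin: "finite E" "finite E'"
    and pairs: "\<And>e. e \<in> E \<Longrightarrow> card e = 2" "\<And>e. e \<in> E' \<Longrightarrow> card e = 2"
    and bij: "bij_betw h (cluster_edges E) (cluster_edges E')"
    and mult: "\<And>F F'. \<lbrakk>F \<in> cluster_edges E; F' \<in> cluster_edges E; F \<noteq> F'\<rbrakk> \<Longrightarrow>
                 card (\<Inter> (sym_diff (h F) (h F'))) = card (\<Inter> (sym_diff F F'))"
  shows "\<exists>\<psi>. bij_betw \<psi> (\<Union> E) (\<Union> E') \<and>
    (\<forall>u\<in>\<Union> E. \<forall>v\<in>\<Union> E. u \<noteq> v \<longrightarrow> ({u, v} \<in> E \<longleftrightarrow> {\<psi> u, \<psi> v} \<in> E'))"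
proof -
  let ?X = "cluster_edges E" and ?X' = "cluster_edges E'"
  let ?k = "inv_into ?X h"
  define M where "M = h {}"
  have kbij: "bij_betw ?k ?X' ?X" using bij by (rule bij_betw_inv_into)
  have hk: "h (?k F) = F" if "F \<in> ?X'" for F using bij that by (rule bij_betw_inv_into_right)
  have kmult: "card (\<Inter> (sym_diff (?k F) (?k F'))) = card (\<Inter> (sym_diff F F'))"
    if FF: "F \<in> ?X'" "F' \<in> ?X'" "F \<noteq> F'" for F F'
  proof -
    have "?k F \<noteq> ?k F'" using hk[OF FF(1)] hk[OF FF(2)] FF(3) by metis
    from mult[OF bij_betw_apply[OF kbij FF(1)] bij_betw_apply[OF kbij FF(2)] this]
    show ?thesis using hk[OF FF(1)] hk[OF FF(2)] by simp
  qed
  have MX: "M \<in> ?X'" using bij_betw_apply[OF bij empty_in_cluster_edges] M_def by simp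
  then have ME: "M \<subseteq> E'" by (simp add: cluster_edges_def)
  \<comment> \<open>The inequality is applied to \<open>h\<close> and to its inverse.\<close>
  have "card E = card E'"
    using cluster_bij_image_empty(1)[OF fin(2) pairs bij mult]
      cluster_bij_image_empty(1)[OF fin(1) pairs(2,1) kbij kmult] by simp
  then have tog: "sym_diff M {e} \<in> ?X'" if "e \<in> E'" for e
    using cluster_bij_image_empty(2)[OF fin(2) pairs bij mult] that M_def by blast
  have isol: "e \<inter> f = {}" if "e \<in> M" "f \<in> E'" "e \<noteq> f" for e f
    by (rule isolated_if_all_toggles_cluster[OF pairs(2) MX tog that])
  have tX: "sym_diff F M \<in> ?X'" if "F \<in> ?X'" for F
    by (rule sym_diff_isolated_cluster[OF pairs(2) that ME isol])
  have tt: "sym_diff (sym_diff F M) M = F" for F by blast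
  have tbij: "bij_betw (\<lambda>F. sym_diff F M) ?X' ?X'"
    by (rule bij_betw_byWitness[where f' = "\<lambda>F. sym_diff F M"]) (use tX tt in blast)+
  \<comment> \<open>Toggling \<open>M = h {}\<close> after \<open>h\<close> sends \<open>{}\<close>
    to \<open>{}\<close>; it keeps multiplicities because \<open>M\<close> cancels in the symmetric
    difference of two images.\<close>
  let ?h = "\<lambda>F. sym_diff (h F) M"
  have hbij: "bij_betw ?h ?X ?X'"
    using bij_betw_trans[OF bij tbij] by (simp add: o_def)
  have "sym_diff (sym_diff K M) (sym_diff L M) = sym_diff K L" for K L by blast
  then have hmult: "card (\<Inter> (sym_diff (?h F) (?h F'))) = card (\<Inter> (sym_diff F F'))"
    if "F \<in> ?X" "F' \<in> ?X" "F \<noteq> F'" for F F'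
    using mult[OF that] by simp
  have h0: "?h {} = {}" unfolding M_def by blast
  obtain \<phi> where \<phi>: "bij_betw \<phi> E E'"
    "\<forall>e\<in>E. \<forall>f\<in>E. \<forall>g\<in>E. e \<inter> f \<inter> g = {} \<longleftrightarrow> \<phi> e \<inter> \<phi> f \<inter> \<phi> g = {}"
    using ex_edge_bij_of_cluster_bij[where h = ?h, OF pairs hbij hmult h0] by blast
  show ?thesis
    by (rule ex_vertex_bij_of_edge_bij[OF fin pairs \<phi>(1) \<phi>(2)[rule_format]])
qed

section \<open>Stable partitions and the Bell multigraph\<close>

definition nonedges :: "('a, 'b) pre_digraph \<Rightarrow> 'a set set" where
  "nonedges G = {{x, y} | x y. x \<in> verts G \<and> y \<in> verts G \<and> x \<noteq> y \<and> \<not> x \<rightarrow>\<^bsub>G\<^esub> y}"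

definition block_pairs :: "'a set multiset \<Rightarrow> 'a set set" where
  "block_pairs P = {{x, y} | x y. x \<noteq> y \<and> (\<exists>S \<in># P. x \<in> S \<and> y \<in> S)}"

text \<open>The share of \<open>stable_partition\<close> that does not refer to arcs, isolated
  because it is stable under deleting a vertex, with \<open>V\<close> shrinking accordingly.\<close>

definition multipartition :: "'a set \<Rightarrow> nat \<Rightarrow> 'a set multiset \<Rightarrow> bool" where
  "multipartition V k P \<longleftrightarrow>
     (\<exists>U. P = image_mset U (mset_set {..<k}) \<and> disjoint_family_on U {..<k} \<and> (\<Union>i<k. U i) = V)"

lemma stable_partition_iff:
  "stable_partition G k P \<longleftrightarrow> multipartition (verts G) k P \<and> (\<forall>S \<in># P. independent_in G S)"
proof
  assume "stable_partition G k P"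
  then show "multipartition (verts G) k P \<and> (\<forall>S \<in># P. independent_in G S)"
    unfolding stable_partition_def multipartition_def by fastforce
next
  assume A: "multipartition (verts G) k P \<and> (\<forall>S \<in># P. independent_in G S)"
  then obtain U where U: "P = image_mset U (mset_set {..<k})" "disjoint_family_on U {..<k}"
    "(\<Union>i<k. U i) = verts G" unfolding multipartition_def by blast
  have "\<forall>i<k. independent_in G (U i)" using A U(1) by simp
  with U show "stable_partition G k P" unfolding stable_partition_def by blast
qed

lemma multipartition_size: "multipartition V k P \<Longrightarrow> size P = k"
  unfolding multipartition_def by auto

lemma multipartition_blockE:
  assumes "multipartition V k P" "x \<in> V"
  obtains S where "S \<in># P" "x \<in> S"
  using assms unfolding multipartition_def by fastforce

lemma multipartition_subset:
  assumes "multipartition V k P" "S \<in># P"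
  shows "S \<subseteq> V"
  using assms unfolding multipartition_def by fastforce

lemma multipartition_unique_block:
  assumes "multipartition V k P" "S \<in># P" "T \<in># P" "x \<in> S" "x \<in> T"
  shows "S = T"
proof -
  obtain U where U: "P = image_mset U (mset_set {..<k})" "disjoint_family_on U {..<k}"
    using assms(1) unfolding multipartition_def by blast
  obtain i j where ij: "i < k" "S = U i" "j < k" "T = U j"
    using assms(2,3) U(1) by auto
  then show ?thesis using disjoint_family_onD[OF U(2), of i j] assms(4,5) by blast
qed

text \<open>Two indices with the same nonempty part would violate disjointness; only the empty part
  can repeat.\<close>

lemma multipartition_count:
  assumes "multipartition V k P" "S \<noteq> {}"
  shows "count P S = (if S \<in># P then 1 else 0)"
proof (cases "S \<in># P")
  case True
  obtain U where U: "P = image_mset U (mset_set {..<k})" "disjoint_family_on U {..<k}"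
    using assms(1) unfolding multipartition_def by blast
  obtain i where i: "i < k" "S = U i" using True U(1) by auto
  obtain x where x: "x \<in> S" using assms(2) by blast
  have "j = i" if "j < k" "U j = S" for j
    using disjoint_family_onD[OF U(2), of i j] i x that by auto
  then have "U -` {S} \<inter> {..<k} = {i}" using i by auto
  then show ?thesis using True i unfolding U(1) count_image_mset by simp
next
  case False
  then show ?thesis by (simp add: not_in_iff)
qed

lemma pair_in_block_pairs_iff:
  "{x, y} \<in> block_pairs P \<longleftrightarrow> x \<noteq> y \<and> (\<exists>S \<in># P. x \<in> S \<and> y \<in> S)"
  unfolding block_pairs_def by (auto simp: doubleton_eq_iff)

lemma multipartition_block_eq:
  assumes "multipartition V k P" "S \<in># P" "x \<in> S"
  shows "S = insert x {y. {x, y} \<in> block_pairs P}"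
  unfolding pair_in_block_pairs_iff
  using multipartition_unique_block[OF assms(1,2) _ assms(3)] assms(2,3) by blast

text \<open>The block pairs determine the part of each vertex, so the nonempty parts agree, each
  with multiplicity one. The total \<open>k\<close> then fixes the number of empty parts.\<close>

lemma multipartition_eqI:
  assumes P: "multipartition V k P" and Q: "multipartition V k Q"
    and eq: "block_pairs P = block_pairs Q"
  shows "P = Q"
proof -
  have sub: "S \<in># Q"
    if P: "multipartition V k P" and Q: "multipartition V k Q"
      and eq: "block_pairs P = block_pairs Q" and S: "S \<in># P" "S \<noteq> {}" for S P Q
  proof -
    obtain x where x: "x \<in> S" using S(2) by blast
    then have "x \<in> V" using multipartition_subset[OF P S(1)] by blast
    then obtain T where T: "T \<in># Q" "x \<in> T" using multipartition_blockE[OF Q] by blast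
    have "S = T"
      using multipartition_block_eq[OF P S(1) x] multipartition_block_eq[OF Q T] eq by simp
    then show ?thesis using T by simp
  qed
  have cnt: "count P S = count Q S" if "S \<noteq> {}" for S
    using multipartition_count[OF P that] multipartition_count[OF Q that]
      sub[OF P Q eq _ that] sub[OF Q P eq[symmetric] _ that] by metis
  have f: "filter_mset (\<lambda>S. S \<noteq> {}) P = filter_mset (\<lambda>S. S \<noteq> {}) Q"
    by (rule multiset_eqI) (simp add: cnt)
  have dec: "R = filter_mset (\<lambda>S. S = {}) R + filter_mset (\<lambda>S. S \<noteq> {}) R" for R :: "'a set multiset"
    by (rule multiset_partition)
  have "size R = count R {} + size (filter_mset (\<lambda>S. S \<noteq> {}) R)" for R :: "'a set multiset"
    using arg_cong[OF dec[of R], of size] by (simp add: filter_eq_replicate_mset)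
  then have "count P {} = count Q {}"
    using f multipartition_size[OF P] multipartition_size[OF Q] by (metis add_right_cancel)
  then show ?thesis using cnt by (intro multiset_eqI) metis
qed

lemma multipartition_delete_vertex:
  assumes "multipartition V k P"
  shows "multipartition (V - {v}) k (delete_vertex P v)"
proof -
  obtain U where U: "P = image_mset U (mset_set {..<k})" "disjoint_family_on U {..<k}"
    "(\<Union>i<k. U i) = V" using assms unfolding multipartition_def by blast
  show ?thesis unfolding multipartition_def
  proof (intro exI conjI)
    show "delete_vertex P v = image_mset (\<lambda>i. U i - {v}) (mset_set {..<k})"
      unfolding delete_vertex_def U(1) by (simp add: image_mset.compositionality comp_def)
    show "disjoint_family_on (\<lambda>i. U i - {v}) {..<k}"
      using U(2) unfolding disjoint_family_on_def by blast
    show "(\<Union>i<k. U i - {v}) = V - {v}" using U(3) by blast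
  qed
qed

lemma block_pairs_delete_vertex:
  "block_pairs (delete_vertex P v) = {e \<in> block_pairs P. v \<notin> e}"
  unfolding block_pairs_def delete_vertex_def by auto

text \<open>Deleting \<open>v\<close> keeps exactly the block pairs that avoid \<open>v\<close>, and
  a multipartition is determined by its block pairs.\<close>

lemma delete_vertex_eq_iff:
  assumes "multipartition V k P" "multipartition V k Q"
  shows "delete_vertex P v = delete_vertex Q v \<longleftrightarrow>
    (\<forall>e \<in> sym_diff (block_pairs P) (block_pairs Q). v \<in> e)"
proof -
  have "delete_vertex P v = delete_vertex Q v \<longleftrightarrow>
    block_pairs (delete_vertex P v) = block_pairs (delete_vertex Q v)"
    using multipartition_eqI multipartition_delete_vertex assms by metis
  also have "\<dots> \<longleftrightarrow> (\<forall>e \<in> sym_diff (block_pairs P) (block_pairs Q). v \<in> e)"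
    unfolding block_pairs_delete_vertex by blast
  finally show ?thesis .
qed

text \<open>For \<open>P \<noteq> Q\<close> the symmetric difference is nonempty, which confines its
  intersection to \<open>V\<close>.\<close>

lemma multipartition_card_delete_vertex_eq:
  assumes PQ: "multipartition V k P" "multipartition V k Q" "P \<noteq> Q"
  shows "card {v \<in> V. delete_vertex P v = delete_vertex Q v} =
    card (\<Inter> (sym_diff (block_pairs P) (block_pairs Q)))"
proof -
  have "block_pairs P \<noteq> block_pairs Q" using multipartition_eqI PQ by blast
  then obtain e where e: "e \<in> sym_diff (block_pairs P) (block_pairs Q)" by blast
  then have "e \<subseteq> V"
    using multipartition_subset[OF PQ(1)] multipartition_subset[OF PQ(2)]
    unfolding block_pairs_def by blast
  with e have "{v \<in> V. delete_vertex P v = delete_vertex Q v} =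
    \<Inter> (sym_diff (block_pairs P) (block_pairs Q))"
    unfolding delete_vertex_eq_iff[OF PQ(1,2)] by blast
  then show ?thesis by simp
qed

section \<open>Stable partitions as transitive edge sets of the complement\<close>

lemma (in graph) pair_in_nonedges_iff:
  "{x, y} \<in> nonedges G \<longleftrightarrow> x \<in> verts G \<and> y \<in> verts G \<and> x \<noteq> y \<and> \<not> x \<rightarrow> y"
proof -
  have "u \<rightarrow> v \<longleftrightarrow> v \<rightarrow> u" for u v
    using sym_arcs unfolding symmetric_def sym_def by blast
  then show ?thesis unfolding nonedges_def by (auto simp: doubleton_eq_iff)
qed

lemma (in graph) not_dominates_self: "\<not> v \<rightarrow> v"
  using no_loops by (auto simp: arcs_ends_conv)

lemma card_nonedges: "e \<in> nonedges G \<Longrightarrow> card e = 2"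
  unfolding nonedges_def by auto

lemma (in graph) finite_nonedges: "finite (nonedges G)"
  by (rule finite_subset[of _ "Pow (verts G)"]) (auto simp: nonedges_def)

lemma (in graph) block_pairs_stable:
  assumes "stable_partition G k P"
  shows "block_pairs P \<in> cluster_edges (nonedges G)"
proof -
  have P: "multipartition (verts G) k P" and ind: "\<And>S. S \<in># P \<Longrightarrow> independent_in G S"
    using assms unfolding stable_partition_iff by auto
  have "block_pairs P \<subseteq> nonedges G"
    using ind unfolding block_pairs_def nonedges_def independent_in_def by blast
  moreover have "{x, z} \<in> block_pairs P"
    if "{x, y} \<in> block_pairs P" "{y, z} \<in> block_pairs P" "x \<noteq> z" for x y z
    using that multipartition_unique_block[OF P] unfolding pair_in_block_pairs_iff by blast
  ultimately show ?thesis unfolding cluster_edges_def by blast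
qed

text \<open>The parts are the classes of the equivalence relation generated by \<open>F\<close>.
  Every class is the class of some vertex, so there are at most as many classes as vertices and
  empty parts fill up the rest; this is where the number of parts being the order of
  \<open>G\<close> enters.\<close>

lemma (in graph) ex_stable_partition:
  assumes F: "F \<in> cluster_edges (nonedges G)"
  shows "\<exists>P. stable_partition G (card (verts G)) P \<and> block_pairs P = F"
proof -
  define cls where "cls x = insert x {y. {x, y} \<in> F}" for x
  let ?V = "verts G" and ?B = "cls ` verts G"
  have FN: "F \<subseteq> nonedges G" using F by (simp add: cluster_edges_def)
  have ne: "x \<noteq> y" "x \<in> ?V" "y \<in> ?V" "\<not> x \<rightarrow> y" if "{x, y} \<in> F" for x y
    using that FN pair_in_nonedges_iff by blast+
  have rel: "y = z \<or> {y, z} \<in> F" if yz: "y \<in> cls x" "z \<in> cls x" for x y z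
  proof -
    consider "y = x" | "z = x" | "{x, y} \<in> F" "{x, z} \<in> F"
      using yz unfolding cls_def by blast
    then show ?thesis
    proof cases
      case 3
      then have "{y, x} \<in> F" by (simp add: insert_commute)
      then show ?thesis using cluster_edgesD[OF F] 3(2) by blast
    next
      case 2
      then have "y = z \<or> {z, y} \<in> F" using yz unfolding cls_def by blast
      then show ?thesis by (simp add: insert_commute)
    qed (use yz in \<open>auto simp: cls_def\<close>)
  qed
  have cls_eq: "cls x = cls y" if "z \<in> cls x" "z \<in> cls y" for x y z
  proof -
    have "cls x = cls z" if "z \<in> cls x" for x z
    proof (intro equalityI subsetI)
      fix w assume "w \<in> cls x"
      then show "w \<in> cls z" using rel[OF that] unfolding cls_def by blast
    next
      fix w assume w: "w \<in> cls z"
      have "x \<in> cls z" using rel[OF that, of x] unfolding cls_def by blast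
      then show "w \<in> cls x" using rel[OF _ w] unfolding cls_def by blast
    qed
    then show ?thesis using that by metis
  qed
  have cV: "card ?B \<le> card ?V" by (rule card_image_le) simp
  obtain h where h: "bij_betw h {0..<card ?B} ?B"
    using ex_bij_betw_nat_finite[of ?B] by auto
  \<comment> \<open>The first \<open>card ?B\<close> indices enumerate the classes without
    repetition; later ones receive the empty part.\<close>
  define U where "U i = (if i < card ?B then h i else {})" for i
  let ?n = "card ?V"
  let ?P = "image_mset U (mset_set {..<?n})"
  have UB: "U i = {} \<or> U i \<in> ?B" for i
    using bij_betw_apply[OF h, of i] by (auto simp: U_def)
  have BU: "\<exists>i<?n. U i = S" if S: "S \<in> ?B" for S
  proof -
    have "S \<in> h ` {0..<card ?B}" using S h by (simp add: bij_betw_def)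
    then obtain i where "i < card ?B" "h i = S" by auto
    then show ?thesis using cV by (intro exI[of _ i]) (simp add: U_def)
  qed
  have disj: "disjoint_family_on U {..<?n}"
    unfolding disjoint_family_on_def
  proof (intro ballI impI)
    fix i j :: nat assume ij: "i \<noteq> j"
    show "U i \<inter> U j = {}"
    proof (rule ccontr)
      assume ne': "U i \<inter> U j \<noteq> {}"
      then have lt: "i < card ?B" "j < card ?B" by (auto simp: U_def split: if_splits)
      have "U i \<in> ?B" "U j \<in> ?B" using ne' UB[of i] UB[of j] by auto
      then have "U i = U j" using ne' cls_eq by blast
      then have "i = j" using lt bij_betw_imp_inj_on[OF h] by (auto simp: U_def dest: inj_onD)
      then show False using ij by simp
    qed
  qed
  have clsV: "cls x \<subseteq> ?V" if "x \<in> ?V" for x using ne that by (auto simp: cls_def)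
  have un: "(\<Union>i<?n. U i) = ?V"
  proof (intro equalityI subsetI)
    fix x assume "x \<in> (\<Union>i<?n. U i)"
    then show "x \<in> ?V" using UB clsV by blast
  next
    fix x assume x: "x \<in> ?V"
    then obtain i where "i < ?n" "U i = cls x" using BU[of "cls x"] by blast
    then show "x \<in> (\<Union>i<?n. U i)" by (auto simp: cls_def)
  qed
  have ind: "independent_in G (U i)" for i
  proof (cases "U i = {}")
    case False
    then obtain x where x: "x \<in> ?V" "U i = cls x" using UB by blast
    show ?thesis unfolding independent_in_def x(2)
      using clsV[OF x(1)] rel ne(4) not_dominates_self by blast
  qed (simp add: independent_in_def)
  have "stable_partition G ?n ?P"
    unfolding stable_partition_def using disj un ind by blast
  moreover have "block_pairs ?P = F"
  proof (intro equalityI subsetI)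
    fix e assume "e \<in> block_pairs ?P"
    then obtain x y S where xy: "e = {x, y}" "x \<noteq> y" "S \<in># ?P" "x \<in> S" "y \<in> S"
      unfolding block_pairs_def by blast
    then have "S \<in> ?B" using UB by fastforce
    then show "e \<in> F" using rel xy by blast
  next
    fix e assume e: "e \<in> F"
    then obtain x y where xy: "e = {x, y}" using FN unfolding nonedges_def by blast
    then obtain i where i: "i < ?n" "U i = cls x" using BU[of "cls x"] ne e by blast
    then have "cls x \<in># ?P" by auto
    moreover have "x \<in> cls x" "y \<in> cls x" using e xy by (auto simp: cls_def)
    ultimately show "e \<in> block_pairs ?P" using e xy ne unfolding xy pair_in_block_pairs_iff by blast
  qed
  ultimately show ?thesis by blast
qed

lemma (in graph) bij_betw_block_pairs:
  "bij_betw block_pairs {P. stable_partition G (card (verts G)) P} (cluster_edges (nonedges G))"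
  unfolding bij_betw_def
proof
  show "inj_on block_pairs {P. stable_partition G (card (verts G)) P}"
    by (rule inj_onI) (auto simp: stable_partition_iff intro: multipartition_eqI)
  show "block_pairs ` {P. stable_partition G (card (verts G)) P} = cluster_edges (nonedges G)"
    using block_pairs_stable ex_stable_partition by blast
qed

text \<open>Parallel edges differ only in their tag, so they are counted by the vertices whose
  deletion identifies \<open>P\<close> and \<open>Q\<close>; this condition is symmetric in the two
  ends.\<close>

lemma bell_multigraph_multiplicity:
  assumes "stable_partition G k P" "stable_partition G k Q" "P \<noteq> Q"
  shows "card {e \<in> medges (bell_multigraph k G). mends (bell_multigraph k G) e = {P, Q}} =
    card (\<Inter> (sym_diff (block_pairs P) (block_pairs Q)))"
proof -
  let ?D = "{v \<in> verts G. delete_vertex P v = delete_vertex Q v}"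
  have "{e \<in> medges (bell_multigraph k G). mends (bell_multigraph k G) e = {P, Q}} = Pair {P, Q} ` ?D"
    (is "?L = _")
  proof (intro equalityI subsetI)
    fix e assume "e \<in> ?L"
    then obtain P' Q' v where e: "e = ({P', Q'}, v)" "{P', Q'} = {P, Q}" "v \<in> verts G"
      "delete_vertex P' v = delete_vertex Q' v"
      unfolding bell_multigraph_def by auto
    have "delete_vertex P v = delete_vertex Q v"
      using e(2,4) by (auto simp: doubleton_eq_iff)
    then show "e \<in> Pair {P, Q} ` ?D" using e by simp
  next
    fix e assume "e \<in> Pair {P, Q} ` ?D"
    then show "e \<in> ?L" using assms unfolding bell_multigraph_def by auto
  qed
  then have "card ?L = card ?D" by (simp add: card_image inj_on_def)
  then show ?thesis
    using multipartition_card_delete_vertex_eq assms unfolding stable_partition_iff by metis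
qed

text \<open>By \<open>ends\<close>, endpoint sets lie where \<open>f\<close> is injective, so the
  image of an endpoint set determines it and \<open>g\<close> restricts to a bijection between
  bundles of parallel edges.\<close>

lemma multigraph_iso_multiplicityE:
  assumes "multigraph_iso M N" and ends: "\<And>e. e \<in> medges M \<Longrightarrow> mends M e \<subseteq> mverts M"
  obtains f where "bij_betw f (mverts M) (mverts N)"
    "\<And>P Q. \<lbrakk>P \<in> mverts M; Q \<in> mverts M\<rbrakk> \<Longrightarrow>
       card {e \<in> medges N. mends N e = {f P, f Q}} = card {e \<in> medges M. mends M e = {P, Q}}"
proof -
  obtain f g where f: "bij_betw f (mverts M) (mverts N)" and g: "bij_betw g (medges M) (medges N)"
    and fg: "\<And>e. e \<in> medges M \<Longrightarrow> mends N (g e) = f ` mends M e"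
    using assms(1) unfolding multigraph_iso_def by blast
  have "card {e \<in> medges N. mends N e = {f P, f Q}} = card {e \<in> medges M. mends M e = {P, Q}}"
    if PQ: "P \<in> mverts M" "Q \<in> mverts M" for P Q
  proof -
    have iff: "mends N (g e) = {f P, f Q} \<longleftrightarrow> mends M e = {P, Q}" if "e \<in> medges M" for e
    proof -
      have "f ` mends M e = f ` {P, Q} \<longleftrightarrow> mends M e = {P, Q}"
        by (rule inj_on_image_eq_iff[OF bij_betw_imp_inj_on[OF f]]) (use ends that PQ in auto)
      then show ?thesis using fg[OF that] by simp
    qed
    have "{e \<in> medges N. mends N e = {f P, f Q}} = g ` {e \<in> medges M. mends M e = {P, Q}}"
      unfolding bij_betw_imp_surj_on[OF g, symmetric] using iff by auto
    moreover have "inj_on g {e \<in> medges M. mends M e = {P, Q}}"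
      by (rule inj_on_subset[OF bij_betw_imp_inj_on[OF g]]) blast
    ultimately show ?thesis by (simp add: card_image)
  qed
  with f show ?thesis by (rule that)
qed

section \<open>The core\<close>

text \<open>A vertex is not universal iff it has a non-neighbour other than itself, that is, iff it
  lies on an edge of the complement.\<close>

lemma (in graph) verts_core: "verts (core G) = \<Union> (nonedges G)"
proof (intro equalityI subsetI)
  fix v assume "v \<in> verts (core G)"
  then obtain u where "v \<in> verts G" "u \<in> verts G" "v \<noteq> u" "\<not> v \<rightarrow> u"
    unfolding core_def universal_vertex_def by auto
  then have "{v, u} \<in> nonedges G" using pair_in_nonedges_iff by simp
  then show "v \<in> \<Union> (nonedges G)" by blast
next
  fix v assume "v \<in> \<Union> (nonedges G)"
  then obtain e where e: "e \<in> nonedges G" "v \<in> e" by blast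
  then obtain x y where "e = {x, y}" unfolding nonedges_def by blast
  then obtain u where "e = {v, u}" using e(2) by (metis insertE insert_commute singletonD)
  then have "v \<in> verts G" "u \<in> verts G - {v}" "\<not> v \<rightarrow> u"
    using e(1) pair_in_nonedges_iff[of v u] by auto
  then show "v \<in> verts (core G)" unfolding core_def universal_vertex_def by auto
qed

lemma (in graph) dominates_core_iff:
  assumes "u \<in> verts (core G)" "v \<in> verts (core G)"
  shows "u \<rightarrow>\<^bsub>core G\<^esub> v \<longleftrightarrow> u \<noteq> v \<and> {u, v} \<notin> nonedges G"
proof -
  have V: "u \<in> verts G" "v \<in> verts G" using assms unfolding core_def by auto
  have "u \<rightarrow>\<^bsub>core G\<^esub> v \<longleftrightarrow> u \<rightarrow> v"
    using assms unfolding core_def arcs_ends_conv by auto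
  then show ?thesis using V pair_in_nonedges_iff not_dominates_self by blast
qed

lemma (in graph) nomulti_digraph_core: "nomulti_digraph (core G)"
proof -
  interpret C: wf_digraph "core G" unfolding core_def by blast
  show ?thesis by unfold_locales (auto simp: core_def intro: no_multi_arcs)
qed

text \<open>Without parallel arcs an arc is determined by its ends, so \<open>\<psi>\<close>
  dictates the map on arcs. This property of \<open>G\<close> gives injectivity, that of
  \<open>H\<close> surjectivity.\<close>

lemma digraph_iso_of_vertex_bij:
  assumes "nomulti_digraph G" "nomulti_digraph H" and bij: "bij_betw \<psi> (verts G) (verts H)"
    and dom: "\<And>u v. \<lbrakk>u \<in> verts G; v \<in> verts G\<rbrakk> \<Longrightarrow> u \<rightarrow>\<^bsub>G\<^esub> v \<longleftrightarrow> \<psi> u \<rightarrow>\<^bsub>H\<^esub> \<psi> v"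
  shows "digraph_iso G H"
proof -
  interpret G: nomulti_digraph G by fact
  interpret H: nomulti_digraph H by fact
  have "\<exists>b\<in>arcs H. tail H b = \<psi> (tail G a) \<and> head H b = \<psi> (head G a)" if "a \<in> arcs G" for a
  proof -
    have "tail G a \<rightarrow>\<^bsub>G\<^esub> head G a" using that by (auto simp: arcs_ends_conv)
    then have "\<psi> (tail G a) \<rightarrow>\<^bsub>H\<^esub> \<psi> (head G a)" using dom that by simp
    then show ?thesis by (auto simp: arcs_ends_conv)
  qed
  then obtain \<alpha> where \<alpha>: "\<And>a. a \<in> arcs G \<Longrightarrow>
    \<alpha> a \<in> arcs H \<and> tail H (\<alpha> a) = \<psi> (tail G a) \<and> head H (\<alpha> a) = \<psi> (head G a)" by metis
  have inj: "inj_on \<psi> (verts G)" using bij by (rule bij_betw_imp_inj_on)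
  have inj\<alpha>: "inj_on \<alpha> (arcs G)"
  proof (rule inj_onI)
    fix a b assume ab: "a \<in> arcs G" "b \<in> arcs G" "\<alpha> a = \<alpha> b"
    then have "\<psi> (tail G a) = \<psi> (tail G b)" "\<psi> (head G a) = \<psi> (head G b)" using \<alpha> by metis+
    then have "tail G a = tail G b" "head G a = head G b"
      using ab by (auto dest: inj_onD[OF inj])
    then show "a = b" using G.no_multi_arcs ab by (simp add: arc_to_ends_def)
  qed
  have surj\<alpha>: "arcs H = \<alpha> ` arcs G"
  proof (intro equalityI subsetI)
    fix b assume b: "b \<in> arcs H"
    then have "tail H b \<in> \<psi> ` verts G" "head H b \<in> \<psi> ` verts G"
      using bij by (simp_all add: bij_betw_def)
    then obtain u v where uv: "u \<in> verts G" "v \<in> verts G" "tail H b = \<psi> u" "head H b = \<psi> v" by blast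
    have "tail H b \<rightarrow>\<^bsub>H\<^esub> head H b" using b by (auto simp: arcs_ends_conv)
    then have "u \<rightarrow>\<^bsub>G\<^esub> v" using dom uv by simp
    then obtain a where a: "a \<in> arcs G" "tail G a = u" "head G a = v" by (auto simp: arcs_ends_conv)
    have "\<alpha> a = b" using H.no_multi_arcs \<alpha>[OF a(1)] a b uv by (simp add: arc_to_ends_def)
    then show "b \<in> \<alpha> ` arcs G" using a by blast
  qed (use \<alpha> in blast)
  \<comment> \<open>The end maps are those of \<open>H\<close> itself, so \<open>app_iso\<close>
    returns exactly \<open>H\<close>, also outside its arcs.\<close>
  let ?f = "\<lparr>iso_verts = \<psi>, iso_arcs = \<alpha>, iso_head = head H, iso_tail = tail H\<rparr>"
  have "G.digraph_isomorphism ?f"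
    unfolding G.digraph_isomorphism_def using G.wf_digraph inj inj\<alpha> \<alpha> by simp
  moreover have "H = app_iso ?f G"
    using surj\<alpha> bij by (simp add: app_iso_def bij_betw_def)
  ultimately show ?thesis unfolding digraph_iso_def by blast
qed

theorem theorem6p7:
  fixes G1 :: "('a, 'b) pre_digraph" and G2 :: "('c, 'd) pre_digraph"
    and n1 n2 :: nat
  assumes "graph G1" and "graph G2"
    and "card (verts G1) = n1" and "card (verts G2) = n2"
    and "multigraph_iso (bell_multigraph n1 G1) (bell_multigraph n2 G2)"
  shows "digraph_iso (core G1) (core G2)"
proof -
  interpret G1: graph G1 by fact
  interpret G2: graph G2 by fact
  let ?B1 = "bell_multigraph n1 G1" and ?B2 = "bell_multigraph n2 G2"
  let ?S1 = "{P. stable_partition G1 n1 P}" and ?S2 = "{P. stable_partition G2 n2 P}"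
  let ?X1 = "cluster_edges (nonedges G1)" and ?X2 = "cluster_edges (nonedges G2)"
  have verts: "mverts ?B1 = ?S1" "mverts ?B2 = ?S2" by (simp_all add: bell_multigraph_def)
  have ends: "mends ?B1 e \<subseteq> mverts ?B1" if "e \<in> medges ?B1" for e
    using that by (auto simp: bell_multigraph_def)
  obtain f where "bij_betw f (mverts ?B1) (mverts ?B2)"
    and "\<And>P Q. \<lbrakk>P \<in> mverts ?B1; Q \<in> mverts ?B1\<rbrakk> \<Longrightarrow>
      card {e \<in> medges ?B2. mends ?B2 e = {f P, f Q}} = card {e \<in> medges ?B1. mends ?B1 e = {P, Q}}"
    using multigraph_iso_multiplicityE[OF assms(5) ends] by blast
  then have f: "bij_betw f ?S1 ?S2"
    and fm: "\<And>P Q. \<lbrakk>P \<in> ?S1; Q \<in> ?S1\<rbrakk> \<Longrightarrow>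
      card {e \<in> medges ?B2. mends ?B2 e = {f P, f Q}} = card {e \<in> medges ?B1. mends ?B1 e = {P, Q}}"
    unfolding verts by blast+
  have b1: "bij_betw block_pairs ?S1 ?X1" using G1.bij_betw_block_pairs assms(3) by simp
  have b2: "bij_betw block_pairs ?S2 ?X2" using G2.bij_betw_block_pairs assms(4) by simp
  let ?p = "inv_into ?S1 block_pairs"
  \<comment> \<open>The given isomorphism, read on transitive edge sets instead of
    partitions.\<close>
  let ?h = "\<lambda>F. block_pairs (f (?p F))"
  have p: "bij_betw ?p ?X1 ?S1" using b1 by (rule bij_betw_inv_into)
  have bp: "block_pairs (?p F) = F" if "F \<in> ?X1" for F
    using b1 that by (rule bij_betw_inv_into_right)
  have h: "bij_betw ?h ?X1 ?X2"
    using bij_betw_trans[OF bij_betw_trans[OF p f] b2] by (simp add: o_def)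
  have mult: "card (\<Inter> (sym_diff (?h F) (?h F'))) = card (\<Inter> (sym_diff F F'))"
    if F: "F \<in> ?X1" "F' \<in> ?X1" "F \<noteq> F'" for F F'
  proof -
    define P Q where "P = ?p F" and "Q = ?p F'"
    have S: "P \<in> ?S1" "Q \<in> ?S1" unfolding P_def Q_def
      using bij_betw_apply[OF p F(1)] bij_betw_apply[OF p F(2)] by blast+
    have eq: "block_pairs P = F" "block_pairs Q = F'" unfolding P_def Q_def using bp F by auto
    then have ne: "P \<noteq> Q" using F(3) by blast
    have S': "f P \<in> ?S2" "f Q \<in> ?S2" using bij_betw_apply[OF f S(1)] bij_betw_apply[OF f S(2)] by blast+
    have ne': "f P \<noteq> f Q" using inj_onD[OF bij_betw_imp_inj_on[OF f] _ S] ne by blast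
    have "card (\<Inter> (sym_diff (block_pairs (f P)) (block_pairs (f Q)))) =
      card (\<Inter> (sym_diff (block_pairs P) (block_pairs Q)))"
      using bell_multigraph_multiplicity[of G1 n1 P Q] bell_multigraph_multiplicity[of G2 n2 "f P" "f Q"]
        fm[OF S] S S' ne ne' by simp
    then show ?thesis unfolding eq unfolding P_def Q_def .
  qed
  have "\<exists>\<psi>. bij_betw \<psi> (\<Union> (nonedges G1)) (\<Union> (nonedges G2)) \<and>
    (\<forall>u\<in>\<Union> (nonedges G1). \<forall>v\<in>\<Union> (nonedges G1).
       u \<noteq> v \<longrightarrow> ({u, v} \<in> nonedges G1 \<longleftrightarrow> {\<psi> u, \<psi> v} \<in> nonedges G2))"
    by (rule ex_vertex_bij_of_cluster_bij[where h = ?h])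
      (fact G1.finite_nonedges G2.finite_nonedges card_nonedges h mult)+
  then obtain \<psi> where \<psi>: "bij_betw \<psi> (verts (core G1)) (verts (core G2))"
    and edge: "\<forall>u\<in>verts (core G1). \<forall>v\<in>verts (core G1).
       u \<noteq> v \<longrightarrow> ({u, v} \<in> nonedges G1 \<longleftrightarrow> {\<psi> u, \<psi> v} \<in> nonedges G2)"
    unfolding G1.verts_core G2.verts_core by (elim exE conjE)
  show ?thesis
  proof (rule digraph_iso_of_vertex_bij[OF _ _ \<psi>])
    fix u v assume uv: "u \<in> verts (core G1)" "v \<in> verts (core G1)"
    \<comment> \<open>Adjacency in a core means being distinct and not an edge of the complement;
      injectivity handles the first condition and \<open>edge\<close> the second.\<close>
    have "\<psi> u = \<psi> v \<longleftrightarrow> u = v"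
      using inj_on_eq_iff[OF bij_betw_imp_inj_on[OF \<psi>] uv] .
    then show "u \<rightarrow>\<^bsub>core G1\<^esub> v \<longleftrightarrow> \<psi> u \<rightarrow>\<^bsub>core G2\<^esub> \<psi> v"
      unfolding G1.dominates_core_iff[OF uv]
        G2.dominates_core_iff[OF bij_betw_apply[OF \<psi> uv(1)] bij_betw_apply[OF \<psi> uv(2)]]
      using bspec[OF bspec[OF edge uv(1)] uv(2)] by auto
  qed (rule G1.nomulti_digraph_core G2.nomulti_digraph_core)+
qed

end
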